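(* Let $X$ be an AB-HO object in a cardinal category $\mathscr C$ and let $\mathcal F$ denote $\mathrm{Fin}_{\mathscr C}(X)$. Then: (A) For any object $Y$ of $\mathscr C$, $Y\prec_{\mathscr C}X$ iff $Y\in\langle\mathcal F\rangle$. (B) The class $\mathcal F$ is a proper finitary structure with (AP). (C) The class $\langle\mathcal F\rangle$ is proper and has (AP).
   Context: For a category $\mathscr C$, $\mathsf{Ob}(\mathscr C)$ is its class of objects, $\mathsf{Mor}_{\mathscr C}(X,Y)$ the arrows from $X$ to $Y$, $\mathrm{Aut}_{\mathscr C}(X)$ the automorphism group of $X$. An arrow $u\in\mathsf{Mor}_{\mathscr C}(X,Y)$ is a monomorphism if $u\circ v=u\circ w$ implies $v=w$ for all arrows $v,w$ with codomain $X$ and common domain. $X\prec_{\mathscr C}Y$ means $\mathsf{Mor}_{\mathscr C}(X,Y)\neq\varnothing$. An object $X$ is absolutely homogeneous (AB-HO) if for any object $A$ and any arrows $u,v\in\mathsf{Mor}_{\mathscr C}(A,X)$ there is $\phi\in\mathrm{Aut}_{\mathscr C}(X)$ with $v=\phi\circ u$. A class $\mathcal E$ of objects is closed under isomorphic copies if it contains every object isomorphic to a member of it; it is proper if there is a set $W$ of objects such that any object from $\mathcal E$ is isomorphic to an object from $W$. A category $\mathscr C$ is cardinal if: (Arr) all arrows in $\mathscr C$ are monomorphisms and $\mathsf{Mor}_{\mathscr C}(X,Y)$ is a set for any objects $X,Y$; (Sys) all direct systems in $\mathscr C$ have (direct) limits; (Card) to any object $X$ there is assigned a cardinal number, called the size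 of $X$ and denoted $|X|$, so that isomorphic objects have the same size; (Lim) any object with infinite size $\alpha$ is isomorphic to the object of the direct limit of some direct system consisting of at most $\alpha$ objects each of which has finite size; (Size) if a direct system consists of $\alpha\geq\aleph_0$ objects each of which has finite size, then the object of its direct limit has size not greater than $\alpha$; (Dir) if $X,Y$ are objects of finite size, $Z$ is an object, and $u\in\mathsf{Mor}_{\mathscr C}(X,Z)$, $v\in\mathsf{Mor}_{\mathscr C}(Y,Z)$ are arbitrary, then there exist an object $W$ of finite size and arrows $\alpha\in\mathsf{Mor}_{\mathscr C}(X,W)$, $\beta\in\mathsf{Mor}_{\mathscr C}(Y,W)$, $\gamma\in\mathsf{Mor}_{\mathscr C}(W,Z)$ with $u=\gamma\circ\alpha$ and $v=\gamma\circ\beta$; (Fin) for any object $X$ the class $\mathrm{Fin}_{\mathscr C}(X)$ of all objects $A$ of finite size such that $A\prec_{\mathscr C}X$ is proper; (Upp) for any object $X$ there is a cardinal $\mathfrak m$ such that $|Y|\leq\mathfrak m$ for every object $Y$ with $Y\prec_{\mathscr C}X$; (Emb) any object $X$ of finite size has the property: whenever a direct system $\langle Z_\alpha,p_{\alpha,\beta}\rangle_{\alpha\leq\beta}$ in $\mathscr C$ is such that the object $W$ of its direct limit satisfies $X\prec_{\mathscr C}W$, then $X\prec_{\mathscr C}Z_\alpha$ for some index $\alpha$. In a cardinal category, a finitary structure is a class $\mathcal F$ of objects of finite size that is closed under isomorphic copies and such that $X\in\mathcal F$ whenever $X$ has finite size, $X\prec_{\mathscr C}Y$ and $Y\in\mathcal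 F$. $\langle\mathcal F\rangle$ is the class of all objects $X$ such that every object $A$ of finite size with $A\prec_{\mathscr C}X$ belongs to $\mathcal F$. A class $\mathcal E$ of objects has (AP) (the amalgamation property) in $\mathscr C$ if: (1) whenever $X,Y,Z\in\mathcal E$ and $u\colon X\to Y$, $v\colon X\to Z$ are arrows of $\mathscr C$, there exist $W\in\mathcal E$ and arrows $p\colon Y\to W$, $q\colon Z\to W$ of $\mathscr C$ with $p\circ u=q\circ v$; and (2) for any $X,Y\in\mathcal E$ there is $Z\in\mathcal E$ with $X\prec_{\mathscr C}Z$ and $Y\prec_{\mathscr C}Z$. *)

theory Defs
  imports Main
begin

unbundle cardinal_syntax

text \<open>Sets versus classes.  A strongly inaccessible cardinal \<open>\<kappa>\<close> plays the role of the universe: sets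
  of HOL play the role of classes, and those of cardinality below \<open>\<kappa>\<close> the role of sets.  Up to
  bijection every such set lives in the carrier type of \<open>\<kappa>\<close>, so index sets and cardinal numbers
  are taken there.\<close>

definition inaccessible :: "'u rel \<Rightarrow> bool" where
  "inaccessible \<kappa> \<longleftrightarrow> Card_order \<kappa> \<and> natLeq <o \<kappa> \<and> regularCard \<kappa> \<and>
     (\<forall>A :: 'u set. |A| <o \<kappa> \<longrightarrow> |Pow A| <o \<kappa>)"

definition small :: "'u rel \<Rightarrow> 'x set \<Rightarrow> bool" where
  "small \<kappa> S \<longleftrightarrow> |S| <o \<kappa>"

definition cardinal_number :: "'u rel \<Rightarrow> 'u rel \<Rightarrow> bool" where
  "cardinal_number \<kappa> m \<longleftrightarrow> Card_order m \<and> m <o \<kappa>"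

text \<open>\<open>Comp C g f\<close> is \<open>g \<circ> f\<close>; it is meaningful only if \<open>Cod C f = Dom C g\<close>.\<close>

record ('o, 'a) cat =
  Obj :: "'o set"
  Arr :: "'a set"
  Dom :: "'a \<Rightarrow> 'o"
  Cod :: "'a \<Rightarrow> 'o"
  Ident :: "'o \<Rightarrow> 'a"
  Comp :: "'a \<Rightarrow> 'a \<Rightarrow> 'a"

definition Mor :: "('o, 'a) cat \<Rightarrow> 'o \<Rightarrow> 'o \<Rightarrow> 'a set" where
  "Mor C X Y = {f \<in> Arr C. Dom C f = X \<and> Cod C f = Y}"

locale category =
  fixes C :: "('o, 'a) cat"
  assumes Dom_in_Obj: "f \<in> Arr C \<Longrightarrow> Dom C f \<in> Obj C"
    and Cod_in_Obj: "f \<in> Arr C \<Longrightarrow> Cod C f \<in> Obj C"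
    and Ident_in_Mor: "X \<in> Obj C \<Longrightarrow> Ident C X \<in> Mor C X X"
    and Comp_in_Mor: "f \<in> Mor C X Y \<Longrightarrow> g \<in> Mor C Y Z \<Longrightarrow> Comp C g f \<in> Mor C X Z"
    and Ident_left: "f \<in> Mor C X Y \<Longrightarrow> Comp C (Ident C Y) f = f"
    and Ident_right: "f \<in> Mor C X Y \<Longrightarrow> Comp C f (Ident C X) = f"
    and Comp_assoc: "f \<in> Mor C X Y \<Longrightarrow> g \<in> Mor C Y Z \<Longrightarrow> h \<in> Mor C Z W \<Longrightarrow>
      Comp C h (Comp C g f) = Comp C (Comp C h g) f"

definition monomorphism :: "('o, 'a) cat \<Rightarrow> 'a \<Rightarrow> bool" where
  "monomorphism C u \<longleftrightarrow> u \<in> Arr C \<and>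
     (\<forall>A \<in> Obj C. \<forall>v \<in> Mor C A (Dom C u). \<forall>w \<in> Mor C A (Dom C u).
        Comp C u v = Comp C u w \<longrightarrow> v = w)"

definition Iso :: "('o, 'a) cat \<Rightarrow> 'o \<Rightarrow> 'o \<Rightarrow> 'a set" where
  "Iso C X Y = {f \<in> Mor C X Y. \<exists>g \<in> Mor C Y X. Comp C g f = Ident C X \<and> Comp C f g = Ident C Y}"

definition Aut :: "('o, 'a) cat \<Rightarrow> 'o \<Rightarrow> 'a set" where
  "Aut C X = Iso C X X"

definition isomorphic :: "('o, 'a) cat \<Rightarrow> 'o \<Rightarrow> 'o \<Rightarrow> bool" where
  "isomorphic C X Y \<longleftrightarrow> Iso C X Y \<noteq> {}"

definition prec :: "('o, 'a) cat \<Rightarrow> 'o \<Rightarrow> 'o \<Rightarrow> bool" where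
  "prec C X Y \<longleftrightarrow> Mor C X Y \<noteq> {}"

definition AB_HO :: "('o, 'a) cat \<Rightarrow> 'o \<Rightarrow> bool" where
  "AB_HO C X \<longleftrightarrow> X \<in> Obj C \<and>
     (\<forall>A \<in> Obj C. \<forall>u \<in> Mor C A X. \<forall>v \<in> Mor C A X. \<exists>\<phi> \<in> Aut C X. v = Comp C \<phi> u)"

definition closed_under_iso :: "('o, 'a) cat \<Rightarrow> 'o set \<Rightarrow> bool" where
  "closed_under_iso C E \<longleftrightarrow> (\<forall>X \<in> E. \<forall>Y \<in> Obj C. isomorphic C X Y \<longrightarrow> Y \<in> E)"

definition proper :: "'u rel \<Rightarrow> ('o, 'a) cat \<Rightarrow> 'o set \<Rightarrow> bool" where
  "proper \<kappa> C E \<longleftrightarrow> (\<exists>W \<subseteq> Obj C. small \<kappa> W \<and> (\<forall>X \<in> E. \<exists>Y \<in> W. isomorphic C X Y))"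

definition directed_set :: "'i set \<Rightarrow> 'i rel \<Rightarrow> bool" where
  "directed_set I le \<longleftrightarrow> I \<noteq> {} \<and> le \<subseteq> I \<times> I \<and> refl_on I le \<and> trans le \<and>
     (\<forall>i \<in> I. \<forall>j \<in> I. \<exists>k \<in> I. (i, k) \<in> le \<and> (j, k) \<in> le)"

text \<open>The connecting arrow \<open>p i j\<close> goes from \<open>Z i\<close> to \<open>Z j\<close>, for \<open>i \<le> j\<close>.\<close>

definition direct_system ::
  "'u rel \<Rightarrow> ('o, 'a) cat \<Rightarrow> 'i set \<Rightarrow> 'i rel \<Rightarrow> ('i \<Rightarrow> 'o) \<Rightarrow> ('i \<Rightarrow> 'i \<Rightarrow> 'a) \<Rightarrow> bool" where
  "direct_system \<kappa> C I le Z p \<longleftrightarrow> small \<kappa> I \<and> directed_set I le \<and>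
     (\<forall>i \<in> I. Z i \<in> Obj C \<and> p i i = Ident C (Z i)) \<and>
     (\<forall>i j. (i, j) \<in> le \<longrightarrow> p i j \<in> Mor C (Z i) (Z j)) \<and>
     (\<forall>i j k. (i, j) \<in> le \<and> (j, k) \<in> le \<longrightarrow> Comp C (p j k) (p i j) = p i k)"

definition cocone ::
  "('o, 'a) cat \<Rightarrow> 'i set \<Rightarrow> 'i rel \<Rightarrow> ('i \<Rightarrow> 'o) \<Rightarrow> ('i \<Rightarrow> 'i \<Rightarrow> 'a) \<Rightarrow> 'o \<Rightarrow> ('i \<Rightarrow> 'a) \<Rightarrow> bool" where
  "cocone C I le Z p L q \<longleftrightarrow> L \<in> Obj C \<and> (\<forall>i \<in> I. q i \<in> Mor C (Z i) L) \<and>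
     (\<forall>i j. (i, j) \<in> le \<longrightarrow> Comp C (q j) (p i j) = q i)"

definition direct_limit ::
  "('o, 'a) cat \<Rightarrow> 'i set \<Rightarrow> 'i rel \<Rightarrow> ('i \<Rightarrow> 'o) \<Rightarrow> ('i \<Rightarrow> 'i \<Rightarrow> 'a) \<Rightarrow> 'o \<Rightarrow> ('i \<Rightarrow> 'a) \<Rightarrow> bool" where
  "direct_limit C I le Z p L q \<longleftrightarrow> cocone C I le Z p L q \<and>
     (\<forall>M r. cocone C I le Z p M r \<longrightarrow> (\<exists>!h. h \<in> Mor C L M \<and> (\<forall>i \<in> I. Comp C h (q i) = r i)))"

text \<open>The size function \<open>sz\<close> assigns to each object a cardinal in the sense of
  \<^theory>\<open>HOL.BNF_Cardinal_Order_Relation\<close>; equality of sizes is \<open>=o\<close>.\<close>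

definition finite_size :: "('o \<Rightarrow> 'u rel) \<Rightarrow> 'o \<Rightarrow> bool" where
  "finite_size sz X \<longleftrightarrow> finite (Field (sz X))"

definition Fin :: "('o, 'a) cat \<Rightarrow> ('o \<Rightarrow> 'u rel) \<Rightarrow> 'o \<Rightarrow> 'o set" where
  "Fin C sz X = {A \<in> Obj C. finite_size sz A \<and> prec C A X}"

locale cardinal_category = category C
  for \<kappa> :: "'u rel" and C :: "('o, 'a) cat" and sz :: "'o \<Rightarrow> 'u rel" +
  assumes Arr_mono: "u \<in> Arr C \<Longrightarrow> monomorphism C u"
    and Arr_small: "X \<in> Obj C \<Longrightarrow> Y \<in> Obj C \<Longrightarrow> small \<kappa> (Mor C X Y)"
    and Sys: "\<And>(I :: 'u set) le Z p. direct_system \<kappa> C I le Z p \<Longrightarrow> \<exists>L q. direct_limit C I le Z p L q"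
    and Card: "X \<in> Obj C \<Longrightarrow> cardinal_number \<kappa> (sz X)"
    and Card_iso: "X \<in> Obj C \<Longrightarrow> Y \<in> Obj C \<Longrightarrow> isomorphic C X Y \<Longrightarrow> sz X =o sz Y"
    and Lim: "X \<in> Obj C \<Longrightarrow> \<not> finite_size sz X \<Longrightarrow>
      \<exists>(I :: 'u set) le Z p L q. direct_system \<kappa> C I le Z p \<and> |I| \<le>o sz X \<and>
        (\<forall>i \<in> I. finite_size sz (Z i)) \<and> direct_limit C I le Z p L q \<and> isomorphic C X L"
    and Size: "\<And>(I :: 'u set) le Z p L q. direct_system \<kappa> C I le Z p \<Longrightarrow> infinite I \<Longrightarrow>
      (\<forall>i \<in> I. finite_size sz (Z i)) \<Longrightarrow> direct_limit C I le Z p L q \<Longrightarrow> sz L \<le>o |I|"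
    and Dir: "X \<in> Obj C \<Longrightarrow> Y \<in> Obj C \<Longrightarrow> Z \<in> Obj C \<Longrightarrow> finite_size sz X \<Longrightarrow> finite_size sz Y \<Longrightarrow>
      u \<in> Mor C X Z \<Longrightarrow> v \<in> Mor C Y Z \<Longrightarrow>
      \<exists>W \<in> Obj C. finite_size sz W \<and>
        (\<exists>\<alpha> \<in> Mor C X W. \<exists>\<beta> \<in> Mor C Y W. \<exists>\<gamma> \<in> Mor C W Z. u = Comp C \<gamma> \<alpha> \<and> v = Comp C \<gamma> \<beta>)"
    and Fin: "X \<in> Obj C \<Longrightarrow> proper \<kappa> C (Fin C sz X)"
    and Upp: "X \<in> Obj C \<Longrightarrow>
      \<exists>m. cardinal_number \<kappa> m \<and> (\<forall>Y \<in> Obj C. prec C Y X \<longrightarrow> sz Y \<le>o m)"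
    and Emb: "\<And>X (I :: 'u set) le Z p W q. X \<in> Obj C \<Longrightarrow> finite_size sz X \<Longrightarrow>
      direct_system \<kappa> C I le Z p \<Longrightarrow> direct_limit C I le Z p W q \<Longrightarrow> prec C X W \<Longrightarrow>
      \<exists>i \<in> I. prec C X (Z i)"

definition finitary_structure :: "('o, 'a) cat \<Rightarrow> ('o \<Rightarrow> 'u rel) \<Rightarrow> 'o set \<Rightarrow> bool" where
  "finitary_structure C sz F \<longleftrightarrow> F \<subseteq> Obj C \<and> (\<forall>X \<in> F. finite_size sz X) \<and> closed_under_iso C F \<and>
     (\<forall>X \<in> Obj C. \<forall>Y \<in> F. finite_size sz X \<and> prec C X Y \<longrightarrow> X \<in> F)"

definition generated :: "('o, 'a) cat \<Rightarrow> ('o \<Rightarrow> 'u rel) \<Rightarrow> 'o set \<Rightarrow> 'o set" where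
  "generated C sz F = {X \<in> Obj C. \<forall>A \<in> Obj C. finite_size sz A \<and> prec C A X \<longrightarrow> A \<in> F}"

definition AP :: "('o, 'a) cat \<Rightarrow> 'o set \<Rightarrow> bool" where
  "AP C E \<longleftrightarrow>
     (\<forall>X \<in> E. \<forall>Y \<in> E. \<forall>Z \<in> E. \<forall>u \<in> Mor C X Y. \<forall>v \<in> Mor C X Z.
        \<exists>W \<in> E. \<exists>p \<in> Mor C Y W. \<exists>q \<in> Mor C Z W. Comp C p u = Comp C q v) \<and>
     (\<forall>X \<in> E. \<forall>Y \<in> E. \<exists>Z \<in> E. prec C X Z \<and> prec C Y Z)"

end

theory Submission
  imports "HOL-Algebra.Free_Abelian_Groups" Defs
begin

text \<open>
  Everything rests on one fact: a direct system all of whose objects embed in an absolutely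
  homogeneous \<open>X\<close> has a cocone to \<open>X\<close>, so that its limit embeds in \<open>X\<close> too
  (\<open>AB_HO_cocone_exists\<close>).  An object of \<open>\<langle>\<F>\<rangle>\<close> of infinite size is the limit of a system of
  finite-size objects, each of which lies in \<open>\<F>\<close>; hence it embeds in \<open>X\<close>, which is the nontrivial
  half of the description of \<open>\<langle>\<F>\<rangle>\<close> (\<open>prec_AB_HO_iff_generated\<close>).

  Homogeneity makes cocones extendable.  Suppose that \<open>q\<close> is a cocone to \<open>X\<close> on a directed part
  \<open>J\<close> of the system, and that the whole system has some cocone \<open>r\<close> to \<open>X\<close>.  Then \<open>q\<close> and the
  restriction of \<open>r\<close> give two arrows to \<open>X\<close> from the limit over \<open>J\<close>.  An automorphism \<open>\<phi>\<close> of
  \<open>X\<close> carries the second to the first, and \<open>\<phi> \<circ> r\<close> extends \<open>q\<close> (\<open>AB_HO_extend_cocone\<close>).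

  Existence of a cocone follows by induction on the cardinality of the index set \<open>I\<close>.  A finite
  directed set has a greatest element, and an arrow from the object there suffices.  An infinite
  \<open>I\<close> is the union of a well-ordered increasing chain of directed subsets of smaller cardinality
  (Iwamura's lemma; here through \<open>directed_hull\<close>).  By the induction hypothesis each of them
  carries a cocone, and transfinite recursion with the extension property makes these cocones
  coherent, so that their union is a cocone on \<open>I\<close>.  An arbitrary directed index set need have no
  cofinal chain, which is why it is exhausted by directed subsets and not by elements.

  Amalgamation takes place inside \<open>X\<close>: homogeneity lets two extensions \<open>Y\<close>, \<open>Z\<close> of \<open>A\<close> be
  embedded in \<open>X\<close> so as to agree on \<open>A\<close>.  For \<open>\<langle>\<F>\<rangle>\<close> the object \<open>X\<close> itself is the amalgam; for
  \<open>\<F>\<close> the axiom (Dir) cuts it down to finite size, and monomorphy keeps the square commutative.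

  Properness of \<open>\<langle>\<F>\<rangle>\<close> holds because an object \<open>Y\<close> with an arrow \<open>y\<close> to \<open>X\<close> is determined up to
  isomorphism by the set of those arrows to \<open>X\<close> that factor through \<open>y\<close> and start in a
  representative of \<open>\<F>\<close> (\<open>proper_prec\<close>).  There are at most as many such sets as subsets of a
  small set of arrows, and inaccessibility makes this number small.
\<close>

section \<open>Small sets\<close>

lemma small_subset: "small \<kappa> S \<Longrightarrow> T \<subseteq> S \<Longrightarrow> small \<kappa> T"
  using card_of_mono1 ordLeq_ordLess_trans unfolding small_def by blast

lemma small_image: "small \<kappa> S \<Longrightarrow> small \<kappa> (f ` S)"
  using card_of_image ordLeq_ordLess_trans unfolding small_def by blast

text \<open>Inaccessibility speaks of subsets of the carrier type of \<open>\<kappa>\<close> only; a small set of any type is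
  first moved there by an injection.\<close>

lemma small_Pow:
  fixes \<kappa> :: "'u rel" and S :: "'x set"
  assumes \<kappa>: "inaccessible \<kappa>" and S: "small \<kappa> S"
  shows "small \<kappa> (Pow S)"
proof -
  have card: "|Field \<kappa>| =o \<kappa>"
    using \<kappa> card_of_Field_ordIso unfolding inaccessible_def by blast
  then have "|S| \<le>o |Field \<kappa>|"
    using S ordLess_imp_ordLeq ordLeq_ordIso_trans ordIso_symmetric unfolding small_def by blast
  then obtain f :: "'x \<Rightarrow> 'u" where f: "inj_on f S"
    using card_of_ordLeq[of S "Field \<kappa>"] by blast
  have "|f ` S| <o \<kappa>" using card_of_image S ordLeq_ordLess_trans unfolding small_def by blast
  then have "|Pow (f ` S)| <o \<kappa>" using \<kappa> unfolding inaccessible_def by blast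
  moreover have "|Pow S| =o |Pow (f ` S)|"
    using bij_betw_Pow[OF inj_on_imp_bij_betw[OF f]] card_of_ordIso by blast
  ultimately show ?thesis using ordIso_ordLess_trans unfolding small_def by blast
qed

lemma small_UN:
  assumes \<kappa>: "inaccessible \<kappa>" and I: "small \<kappa> I" and A: "\<And>i. i \<in> I \<Longrightarrow> small \<kappa> (A i)"
  shows "small \<kappa> (\<Union>i \<in> I. A i)"
proof -
  have "Cinfinite \<kappa>"
    using \<kappa> natLeq_Cinfinite unfolding inaccessible_def
    by (meson cinfinite_mono ordLess_imp_ordLeq)
  then show ?thesis
    using regularCard_UNION_bound[of \<kappa> I A] \<kappa> I A unfolding small_def inaccessible_def by blast
qed

section \<open>Directed hulls\<close>

lemma directed_set_finite_upper_bound: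
  fixes le :: "'i rel"
  assumes "directed_set I le" "finite S" "S \<subseteq> I"
  shows "\<exists>k \<in> I. \<forall>s \<in> S. (s, k) \<in> le"
  using assms(2,3)
proof (induction S)
  case empty
  then show ?case using assms(1) by (auto simp: directed_set_def)
next
  case (insert x S)
  then obtain k where k: "k \<in> I" "\<forall>s \<in> S. (s, k) \<in> le" by auto
  obtain m where m: "m \<in> I" "(x, m) \<in> le" "(k, m) \<in> le"
    using assms(1) k insert.prems unfolding directed_set_def by blast
  have "(s, m) \<in> le" if "s \<in> S" for s
  proof -
    have "(s, k) \<in> le" using that k by blast
    then show ?thesis using m(3) assms(1) unfolding directed_set_def by (meson transD)
  qed
  then show ?case using m by blast
qed

text \<open>The form of Iwamura's lemma used below: directed hulls can be chosen monotonically, and without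
  raising the cardinality, even for finite sets.  Closing \<open>S\<close> under a binary upper bound operation
  can make a finite set countably infinite.  Instead, every finite set \<open>T\<close> of indices gets a
  bound \<open>t T\<close> that is also above \<open>t T'\<close> for all \<open>T' \<subset> T\<close>, and the hull of \<open>S\<close> consists of \<open>S\<close>
  and the bounds of its finite subsets: \<open>t A\<close> and \<open>t B\<close> are both below \<open>t (A \<union> B)\<close>.\<close>

lemma directed_hull:
  fixes le :: "'i rel"
  assumes dir: "directed_set I le"
  obtains D where
    "\<And>S. S \<subseteq> I \<Longrightarrow> S \<subseteq> D S \<and> D S \<subseteq> I \<and> directed_set (D S) (Restr le (D S))"
    "\<And>S T. S \<subseteq> T \<Longrightarrow> D S \<subseteq> D T"
    "\<And>S. finite S \<Longrightarrow> finite (D S)"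
    "\<And>S. infinite S \<Longrightarrow> |D S| \<le>o |S|"
proof -
  have refl: "(i, i) \<in> le" if "i \<in> I" for i
    using dir that by (auto simp: directed_set_def refl_on_def)
  have tr: "(i, k) \<in> le" if "(i, j) \<in> le" "(j, k) \<in> le" for i j k
    using dir that unfolding directed_set_def by (meson transD)
  \<comment> \<open>\<open>m\<close> is an admissible bound for \<open>S\<close>, given the bounds \<open>t T\<close> of its proper subsets.\<close>
  define P where "P t S m \<longleftrightarrow> (finite S \<and> S \<subseteq> I \<longrightarrow>
    m \<in> I \<and> (\<forall>s \<in> S. (s, m) \<in> le) \<and> (\<forall>T. T \<subset> S \<longrightarrow> (t T, m) \<in> le))" for t S m
  have "\<exists>t. \<forall>S. P t S (t S)"
  proof (rule dependent_wf_choice[OF wf_finite_psubset])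
    fix f g :: "'i set \<Rightarrow> 'i" and S m
    assume "\<And>T. (T, S) \<in> finite_psubset \<Longrightarrow> f T = g T"
    then show "P f S m = P g S m"
      unfolding P_def finite_psubset_def by auto
  next
    fix S and f :: "'i set \<Rightarrow> 'i"
    assume IH: "\<And>T. (T, S) \<in> finite_psubset \<Longrightarrow> P f T (f T)"
    show "\<exists>m. P f S m"
    proof (cases "finite S \<and> S \<subseteq> I")
      case True
      have "f T \<in> I" if "T \<subset> S" for T
        using IH[of T] that True finite_subset unfolding P_def finite_psubset_def by blast
      then have "S \<union> f ` {T. T \<subset> S} \<subseteq> I" using True by auto
      moreover have "finite (S \<union> f ` {T. T \<subset> S})"
        using True by (auto intro: finite_subset[of _ "Pow S"])
      ultimately have "\<exists>k \<in> I. \<forall>s \<in> S \<union> f ` {T. T \<subset> S}. (s, k) \<in> le"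
        by (intro directed_set_finite_upper_bound[OF dir])
      then obtain k where "k \<in> I" "\<forall>s \<in> S \<union> f ` {T. T \<subset> S}. (s, k) \<in> le" by blast
      then have "P f S k" unfolding P_def by blast
      then show ?thesis by blast
    qed (auto simp: P_def)
  qed
  then obtain t where t: "\<And>S. P t S (t S)" by blast
  define D where "D S = S \<union> t ` Fpow S" for S
  show ?thesis
  proof (rule that[of D])
    fix S assume S: "S \<subseteq> I"
    have tI: "t A \<in> I" if "A \<in> Fpow S" for A
      using t[of A] that S by (auto simp: P_def Fpow_def)
    have DI: "D S \<subseteq> I" using S tI by (auto simp: D_def)
    have below: "\<exists>A \<in> Fpow S. (a, t A) \<in> le" if "a \<in> D S" for a
    proof (cases "a \<in> S")
      case True
      then have "(a, t {a}) \<in> le" using t[of "{a}"] S by (auto simp: P_def)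
      then show ?thesis using True by (intro bexI[of _ "{a}"]) (auto simp: Fpow_def)
    next
      case False
      then show ?thesis using that refl tI by (auto simp: D_def)
    qed
    have mono: "(t A, t B) \<in> le" if "A \<subseteq> B" "B \<in> Fpow S" for A B
    proof (cases "A = B")
      case True
      then show ?thesis using refl tI that by auto
    next
      case False
      then have "A \<subset> B" "finite B" "B \<subseteq> I" using that S by (auto simp: Fpow_def)
      then show ?thesis using t[of B] unfolding P_def by blast
    qed
    have "\<exists>c \<in> D S. (a, c) \<in> le \<and> (b, c) \<in> le" if ab: "a \<in> D S" "b \<in> D S" for a b
    proof -
      obtain A where A: "A \<in> Fpow S" "(a, t A) \<in> le" using below[OF ab(1)] by blast
      obtain B where B: "B \<in> Fpow S" "(b, t B) \<in> le" using below[OF ab(2)] by blast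
      have U: "A \<union> B \<in> Fpow S" using A(1) B(1) by (auto simp: Fpow_def)
      have "(a, t (A \<union> B)) \<in> le" "(b, t (A \<union> B)) \<in> le"
        using tr[OF A(2) mono[OF _ U]] tr[OF B(2) mono[OF _ U]] by auto
      then show ?thesis using U by (auto simp: D_def)
    qed
    \<comment> \<open>Even the hull of the empty set has an element, namely \<open>t {}\<close>.\<close>
    moreover have "D S \<noteq> {}" using empty_in_Fpow by (auto simp: D_def)
    moreover have "trans (Restr le (D S))" using tr by (auto intro!: transI)
    moreover have "refl_on (D S) (Restr le (D S))" using DI refl by (auto simp: refl_on_def)
    ultimately have "directed_set (D S) (Restr le (D S))"
      unfolding directed_set_def by auto
    then show "S \<subseteq> D S \<and> D S \<subseteq> I \<and> directed_set (D S) (Restr le (D S))"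
      using DI by (auto simp: D_def)
  next
    fix S T :: "'i set" assume "S \<subseteq> T"
    then show "D S \<subseteq> D T" using Fpow_mono[of S T] by (auto simp: D_def)
  next
    fix S :: "'i set" assume "finite S"
    then show "finite (D S)" by (auto simp: D_def Fpow_def)
  next
    fix S :: "'i set" assume inf: "infinite S"
    have "|t ` Fpow S| \<le>o |S|"
      using card_of_image card_of_Fpow_infinite[OF inf] ordLeq_ordIso_trans by blast
    then show "|D S| \<le>o |S|"
      unfolding D_def by (intro card_of_Un_ordLeq_infinite[OF inf]) auto
  qed
qed

section \<open>Arrows and cocones\<close>

context category
begin

lemma Mor_ObjD:
  assumes "f \<in> Mor C X Y"
  shows "X \<in> Obj C" "Y \<in> Obj C"
  using assms Dom_in_Obj Cod_in_Obj by (auto simp: Mor_def)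

lemma prec_refl: "X \<in> Obj C \<Longrightarrow> prec C X X"
  using Ident_in_Mor by (auto simp: prec_def)

lemma prec_trans: "prec C X Y \<Longrightarrow> prec C Y Z \<Longrightarrow> prec C X Z"
  using Comp_in_Mor unfolding prec_def by blast

lemma isomorphic_imp_prec: "isomorphic C X Y \<Longrightarrow> prec C Y X"
  by (auto simp: isomorphic_def Iso_def prec_def)

lemma direct_system_restrict:
  fixes le :: "'i rel"
  assumes "direct_system \<kappa> C I le Z p" "J \<subseteq> I" "directed_set J (Restr le J)"
  shows "direct_system \<kappa> C J (Restr le J) Z p"
proof -
  have "small \<kappa> J"
    using assms small_subset unfolding direct_system_def by blast
  then show ?thesis using assms unfolding direct_system_def by blast
qed

lemma cocone_restrict:
  fixes le :: "'i rel"
  assumes "cocone C I le Z p L q" "J \<subseteq> I"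
  shows "cocone C J (Restr le J) Z p L q"
  using assms unfolding cocone_def by blast

lemma cocone_postcomp:
  fixes le :: "'i rel"
  assumes sys: "direct_system \<kappa> C I le Z p"
    and q: "cocone C I le Z p L q" and h: "h \<in> Mor C L M"
  shows "cocone C I le Z p M (\<lambda>i. Comp C h (q i))"
  unfolding cocone_def
proof (intro conjI ballI allI impI)
  show "M \<in> Obj C" using h Mor_ObjD by blast
next
  fix i assume "i \<in> I"
  then show "Comp C h (q i) \<in> Mor C (Z i) M"
    using q h Comp_in_Mor unfolding cocone_def by blast
next
  fix i j assume ij: "(i, j) \<in> le"
  then have p: "p i j \<in> Mor C (Z i) (Z j)" and "j \<in> I"
    using sys unfolding direct_system_def directed_set_def by blast+
  then have "q j \<in> Mor C (Z j) L" "Comp C (q j) (p i j) = q i"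
    using q ij unfolding cocone_def by blast+
  then show "Comp C (Comp C h (q j)) (p i j) = Comp C h (q i)"
    using Comp_assoc[OF p _ h] by metis
qed

lemma direct_limit_factor:
  fixes le :: "'i rel"
  assumes "direct_limit C I le Z p L l" "cocone C I le Z p M r"
  shows "\<exists>h \<in> Mor C L M. \<forall>i \<in> I. Comp C h (l i) = r i"
  using assms unfolding direct_limit_def by blast

lemma direct_limit_eqI:
  fixes le :: "'i rel"
  assumes "direct_system \<kappa> C I le Z p" "direct_limit C I le Z p L l"
    and "g \<in> Mor C L M" "h \<in> Mor C L M"
    and "\<And>i. i \<in> I \<Longrightarrow> Comp C g (l i) = Comp C h (l i)"
  shows "g = h"
proof -
  have "cocone C I le Z p M (\<lambda>i. Comp C h (l i))"
    using assms cocone_postcomp unfolding direct_limit_def by blast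
  then have "\<exists>!k. k \<in> Mor C L M \<and> (\<forall>i \<in> I. Comp C k (l i) = Comp C h (l i))"
    using assms(2) unfolding direct_limit_def by simp
  then show ?thesis using assms(3-5) by blast
qed

text \<open>A finite directed set has a greatest element \<open>k\<close>, so any arrow from \<open>Z k\<close> induces a cocone.\<close>

lemma cocone_finite_system:
  fixes le :: "'i rel"
  assumes sys: "direct_system \<kappa> C I le Z p" and "finite I" and below: "\<forall>i \<in> I. prec C (Z i) X"
  shows "\<exists>q. cocone C I le Z p X q"
proof -
  have le: "le \<subseteq> I \<times> I" and dir: "directed_set I le"
    using sys by (auto simp: direct_system_def directed_set_def)
  obtain k where k: "k \<in> I" "\<forall>i \<in> I. (i, k) \<in> le"
    using directed_set_finite_upper_bound[OF dir \<open>finite I\<close>] by blast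
  have top: "cocone C I le Z p (Z k) (\<lambda>i. p i k)"
    using sys k le unfolding cocone_def direct_system_def by blast
  obtain f where "f \<in> Mor C (Z k) X" using below k by (auto simp: prec_def)
  from cocone_postcomp[OF sys top this] show ?thesis by blast
qed

text \<open>Two indices of the union lie in a common member of the chain, and directedness and the cocone
  equations involve finitely many indices at a time.\<close>

lemma cocone_chain_Union:
  fixes le :: "'i rel"
  assumes "A \<noteq> {}"
    and le: "le \<subseteq> I \<times> I" "refl_on I le" "trans le"
    and sub: "\<And>a. a \<in> A \<Longrightarrow> J a \<subseteq> I"
    and dir: "\<And>a. a \<in> A \<Longrightarrow> directed_set (J a) (Restr le (J a))"
    and cc: "\<And>a. a \<in> A \<Longrightarrow> cocone C (J a) (Restr le (J a)) Z p X (f a)"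
    and chain: "\<And>a b. a \<in> A \<Longrightarrow> b \<in> A \<Longrightarrow>
      (J a \<subseteq> J b \<and> (\<forall>i \<in> J a. f b i = f a i)) \<or> (J b \<subseteq> J a \<and> (\<forall>i \<in> J b. f a i = f b i))"
  defines "U \<equiv> \<Union>a \<in> A. J a"
  shows "directed_set U (Restr le U)"
    and "\<exists>g. cocone C U (Restr le U) Z p X g \<and> (\<forall>a \<in> A. \<forall>i \<in> J a. g i = f a i)"
proof -
  have common: "\<exists>a \<in> A. i \<in> J a \<and> j \<in> J a" if "i \<in> U" "j \<in> U" for i j
    using that chain unfolding U_def by blast
  have "\<exists>k \<in> U. (i, k) \<in> Restr le U \<and> (j, k) \<in> Restr le U" if ij: "i \<in> U" "j \<in> U" for i j
  proof -
    obtain a where a: "a \<in> A" "i \<in> J a" "j \<in> J a" using common ij by blast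
    then obtain k where "k \<in> J a" "(i, k) \<in> le" "(j, k) \<in> le"
      using dir[OF a(1)] unfolding directed_set_def by blast
    then show ?thesis using a ij unfolding U_def by blast
  qed
  moreover have "U \<noteq> {}" using \<open>A \<noteq> {}\<close> dir by (force simp: U_def directed_set_def)
  moreover have "refl_on U (Restr le U)"
    using le sub unfolding U_def refl_on_def by blast
  moreover have "trans (Restr le U)" using le(3) by (auto simp: trans_def)
  ultimately show "directed_set U (Restr le U)"
    unfolding directed_set_def by blast
  define g where "g i = f (SOME a. a \<in> A \<and> i \<in> J a) i" for i
  have g: "g i = f a i" if a: "a \<in> A" "i \<in> J a" for a i
  proof -
    let ?b = "SOME a. a \<in> A \<and> i \<in> J a"
    have "?b \<in> A \<and> i \<in> J ?b" by (rule someI[of _ a]) (use a in blast)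
    then show ?thesis using chain[of a ?b] a by (auto simp: g_def)
  qed
  have "cocone C U (Restr le U) Z p X g"
    unfolding cocone_def
  proof (intro conjI ballI allI impI)
    show "X \<in> Obj C" using \<open>A \<noteq> {}\<close> cc unfolding cocone_def by blast
  next
    fix i assume "i \<in> U"
    then show "g i \<in> Mor C (Z i) X" using g cc unfolding U_def cocone_def by auto
  next
    fix i j assume ij: "(i, j) \<in> Restr le U"
    then obtain a where a: "a \<in> A" "i \<in> J a" "j \<in> J a" using common by blast
    then have "Comp C (f a j) (p i j) = f a i" using cc[OF a(1)] ij unfolding cocone_def by blast
    then show "Comp C (g j) (p i j) = g i" using a g by metis
  qed
  then show "\<exists>g. cocone C U (Restr le U) Z p X g \<and> (\<forall>a \<in> A. \<forall>i \<in> J a. g i = f a i)"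
    using g by blast
qed

end

section \<open>Cocones over an absolutely homogeneous object\<close>

context cardinal_category
begin

lemma Comp_cancel:
  assumes "u \<in> Mor C Y Z" "v \<in> Mor C A Y" "w \<in> Mor C A Y" "Comp C u v = Comp C u w"
  shows "v = w"
proof -
  have "monomorphism C u" using assms(1) Arr_mono by (auto simp: Mor_def)
  then show ?thesis
    using assms Mor_ObjD(1)[OF assms(2)] unfolding monomorphism_def Mor_def by blast
qed

text \<open>The only use of homogeneity in the construction of cocones.  The limit over \<open>J\<close> turns the two
  cocones \<open>q\<close> and \<open>r\<close> on \<open>J\<close> into two single arrows \<open>h\<close> and \<open>k\<close> to \<open>X\<close>, which an automorphism of
  \<open>X\<close> can match.\<close>

lemma AB_HO_extend_cocone:
  fixes I :: "'u set" and le :: "'u rel"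
  assumes X: "AB_HO C X" and sys: "direct_system \<kappa> C I le Z p"
    and J: "J \<subseteq> I" "directed_set J (Restr le J)"
    and r: "cocone C I le Z p X r" and q: "cocone C J (Restr le J) Z p X q"
  shows "\<exists>q'. cocone C I le Z p X q' \<and> (\<forall>i \<in> J. q' i = q i)"
proof -
  have sysJ: "direct_system \<kappa> C J (Restr le J) Z p"
    using direct_system_restrict[OF sys J] .
  then obtain L l where L: "direct_limit C J (Restr le J) Z p L l"
    using Sys by blast
  obtain h where h: "h \<in> Mor C L X" "\<And>i. i \<in> J \<Longrightarrow> Comp C h (l i) = q i"
    using direct_limit_factor[OF L q] by blast
  obtain k where k: "k \<in> Mor C L X" "\<And>i. i \<in> J \<Longrightarrow> Comp C k (l i) = r i"
    using direct_limit_factor[OF L cocone_restrict[OF r J(1)]] by blast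
  obtain \<phi> where \<phi>: "\<phi> \<in> Mor C X X" "h = Comp C \<phi> k"
    using X h(1) k(1) Mor_ObjD(1)[OF h(1)] unfolding AB_HO_def Aut_def Iso_def by blast
  have "Comp C \<phi> (r i) = q i" if i: "i \<in> J" for i
  proof -
    have l: "l i \<in> Mor C (Z i) L" using L i unfolding direct_limit_def cocone_def by blast
    show ?thesis using Comp_assoc[OF l k(1) \<phi>(1)] h(2)[OF i] k(2)[OF i] \<phi>(2) by simp
  qed
  then show ?thesis using cocone_postcomp[OF sys r \<phi>(1)] by blast
qed

text \<open>By induction on the cardinality of \<open>I\<close>.  The cardinal well-order \<open>r\<close> of an infinite \<open>I\<close> has proper
  initial segments of smaller cardinality than \<open>I\<close>, and their directed hulls \<open>J \<xi>\<close> stay smaller.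
  Cocones on the \<open>J \<xi>\<close> are chosen by recursion along \<open>r\<close>, each extending all earlier ones.\<close>

lemma AB_HO_cocone_exists:
  fixes I :: "'u set" and le :: "'u rel"
  assumes X: "AB_HO C X" and "direct_system \<kappa> C I le Z p" and "\<forall>i \<in> I. prec C (Z i) X"
  shows "\<exists>q. cocone C I le Z p X q"
  using assms(2,3)
proof (induction I arbitrary: le rule: wf_induct_rule[OF wf_inv_image[OF wf_ordLess, of card_of]])
  case (1 I le)
  note sys = "1.prems"(1) and below = "1.prems"(2)
  show ?case
  proof (cases "finite I")
    case True
    then show ?thesis using cocone_finite_system[OF sys _ below] by blast
  next
    case inf: False
    have dirI: "directed_set I le" using sys by (simp add: direct_system_def)
    then have le: "le \<subseteq> I \<times> I" "refl_on I le" "trans le" by (auto simp: directed_set_def)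
    obtain D where D:
      "\<And>S. S \<subseteq> I \<Longrightarrow> S \<subseteq> D S \<and> D S \<subseteq> I \<and> directed_set (D S) (Restr le (D S))"
      and D_mono: "\<And>S T. S \<subseteq> T \<Longrightarrow> D S \<subseteq> D T"
      and D_fin: "\<And>S. finite S \<Longrightarrow> finite (D S)"
      and D_inf: "\<And>S. infinite S \<Longrightarrow> |D S| \<le>o |S|"
      using directed_hull[OF dirI] by metis
    define r where "r = |I|"
    have wo: "Well_order r" and Field_r: "Field r = I" by (auto simp: r_def)
    then interpret r: wo_rel r by (simp add: wo_rel_def)
    \<comment> \<open>Closed initial segments, so that \<open>\<xi> \<in> J \<xi>\<close> and the hulls cover \<open>I\<close>.\<close>
    define J where "J \<xi> = D (under r \<xi>)" for \<xi>
    have under_I: "under r \<xi> \<subseteq> I" for \<xi>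
      using under_Field[of r \<xi>] Field_r by simp
    have JI: "J \<xi> \<subseteq> I" "directed_set (J \<xi>) (Restr le (J \<xi>))" for \<xi>
      using D[OF under_I] by (auto simp: J_def)
    have J_mono: "J \<eta> \<subseteq> J \<xi>" if "(\<eta>, \<xi>) \<in> r" for \<eta> \<xi>
      unfolding J_def using that by (intro D_mono under_incr r.TRANS)
    have J_self: "\<xi> \<in> J \<xi>" if "\<xi> \<in> I" for \<xi>
      using D[OF under_I[of \<xi>]] that Field_r r.REFL
      unfolding J_def under_def refl_on_def by blast
    have J_less: "|J \<xi>| <o |I|" if "\<xi> \<in> I" for \<xi>
    proof -
      have "|underS r \<xi>| <o |I|"
        using card_of_underS[of r \<xi>] that Field_r by (simp add: r_def)
      moreover have "|{\<xi>}| <o |I|" using inf by (intro finite_ordLess_infinite2) auto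
      ultimately have "|underS r \<xi> \<union> {\<xi>}| <o |I|"
        using card_of_Un_ordLess_infinite[OF inf] by blast
      moreover have "under r \<xi> \<subseteq> underS r \<xi> \<union> {\<xi>}" by (auto simp: under_def underS_def)
      ultimately have less: "|under r \<xi>| <o |I|"
        using card_of_mono1 ordLeq_ordLess_trans by blast
      show ?thesis
      proof (cases "finite (under r \<xi>)")
        case True
        then show ?thesis unfolding J_def using D_fin inf by (intro finite_ordLess_infinite2) auto
      next
        case False
        then show ?thesis unfolding J_def using D_inf less ordLeq_ordLess_trans by blast
      qed
    qed
    have J_cocone: "\<exists>q. cocone C (J \<xi>) (Restr le (J \<xi>)) Z p X q" if "\<xi> \<in> I" for \<xi>
    proof (rule "1.IH"[OF _ direct_system_restrict[OF sys JI]])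
      show "(J \<xi>, I) \<in> inv_image ordLess card_of" using J_less[OF that] by simp
      show "\<forall>i \<in> J \<xi>. prec C (Z i) X" using JI(1) below by blast
    qed
    \<comment> \<open>\<open>g\<close> is an admissible choice at stage \<open>\<xi>\<close>, given the earlier choices \<open>f\<close>.\<close>
    define P where "P f \<xi> g \<longleftrightarrow> (\<xi> \<in> I \<longrightarrow> cocone C (J \<xi>) (Restr le (J \<xi>)) Z p X g \<and>
      (\<forall>\<eta> \<in> underS r \<xi>. \<forall>i \<in> J \<eta>. g i = f \<eta> i))" for f \<xi> and g :: "'u \<Rightarrow> 'a"
    have underS_I: "underS r \<xi> \<subseteq> I" for \<xi>
      unfolding Field_r[symmetric] by (auto simp: underS_def Field_def)
    have compatible: "(J a \<subseteq> J b \<and> (\<forall>i \<in> J a. f b i = f a i)) \<or>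
        (J b \<subseteq> J a \<and> (\<forall>i \<in> J b. f a i = f b i))"
      if "P f a (f a)" "P f b (f b)" "a \<in> I" "b \<in> I" for f a b
    proof (cases "a = b")
      case False
      then have "a \<in> underS r b \<or> b \<in> underS r a"
        using r.TOTAL that Field_r unfolding total_on_def underS_def by blast
      then show ?thesis using that J_mono unfolding P_def underS_def by blast
    qed auto
    have "\<exists>f. \<forall>\<xi>. P f \<xi> (f \<xi>)"
    proof (rule dependent_wf_choice[OF r.WF])
      fix f g :: "'u \<Rightarrow> 'u \<Rightarrow> 'a" and \<xi> h
      assume "\<And>\<eta>. (\<eta>, \<xi>) \<in> r - Id \<Longrightarrow> f \<eta> = g \<eta>"
      then show "P f \<xi> h = P g \<xi> h" unfolding P_def underS_def by auto
    next
      fix \<xi> and f :: "'u \<Rightarrow> 'u \<Rightarrow> 'a"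
      assume "\<And>\<eta>. (\<eta>, \<xi>) \<in> r - Id \<Longrightarrow> P f \<eta> (f \<eta>)"
      then have IH: "P f \<eta> (f \<eta>)" if "\<eta> \<in> underS r \<xi>" for \<eta>
        using that by (auto simp: underS_def)
      show "\<exists>g. P f \<xi> g"
      proof (cases "\<xi> \<in> I")
        case \<xi>: True
        obtain c where c: "cocone C (J \<xi>) (Restr le (J \<xi>)) Z p X c"
          using J_cocone[OF \<xi>] by blast
        show ?thesis
        proof (cases "underS r \<xi> = {}")
          case True
          then show ?thesis using c unfolding P_def by blast
        next
          case False
          \<comment> \<open>The chosen cocones are glued on the union \<open>U\<close> of the earlier stages.  Even when \<open>\<xi>\<close> has no
            immediate predecessor, \<open>U\<close> may be smaller than \<open>J \<xi>\<close>, so extending is still necessary.\<close>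
          define U where "U = (\<Union>\<eta> \<in> underS r \<xi>. J \<eta>)"
          have cc: "cocone C (J \<eta>) (Restr le (J \<eta>)) Z p X (f \<eta>)" if "\<eta> \<in> underS r \<xi>" for \<eta>
            using IH[OF that] that underS_I[of \<xi>] unfolding P_def by blast
          have ch: "(J a \<subseteq> J b \<and> (\<forall>i \<in> J a. f b i = f a i)) \<or>
              (J b \<subseteq> J a \<and> (\<forall>i \<in> J b. f a i = f b i))"
            if "a \<in> underS r \<xi>" "b \<in> underS r \<xi>" for a b
            using compatible[OF IH[OF that(1)] IH[OF that(2)]] that underS_I[of \<xi>] by blast
          note U = cocone_chain_Union
            [where J = J and f = f, OF False le JI(1) JI(2) cc ch, folded U_def]
          obtain u where u: "cocone C U (Restr le U) Z p X u"
            "\<forall>\<eta> \<in> underS r \<xi>. \<forall>i \<in> J \<eta>. u i = f \<eta> i"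
            using U(2) by blast
          have UJ: "U \<subseteq> J \<xi>" unfolding U_def using J_mono by (auto simp: underS_def)
          then have Restr_U: "Restr (Restr le (J \<xi>)) U = Restr le U" by blast
          obtain g where g: "cocone C (J \<xi>) (Restr le (J \<xi>)) Z p X g" "\<forall>i \<in> U. g i = u i"
            using AB_HO_extend_cocone[OF X direct_system_restrict[OF sys JI] UJ _ c, of u]
              U(1) u(1) Restr_U by auto
          have "g i = f \<eta> i" if "\<eta> \<in> underS r \<xi>" "i \<in> J \<eta>" for \<eta> i
            using that g(2) u(2) unfolding U_def by auto
          then show ?thesis using g(1) unfolding P_def by blast
        qed
      qed (simp add: P_def)
    qed
    then obtain f where f: "\<And>\<xi>. P f \<xi> (f \<xi>)" by blast
    have "I \<noteq> {}" using inf by auto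
    have cc: "cocone C (J \<xi>) (Restr le (J \<xi>)) Z p X (f \<xi>)" if "\<xi> \<in> I" for \<xi>
      using f that unfolding P_def by blast
    have "(\<Union>\<xi> \<in> I. J \<xi>) = I" using JI(1) J_self by blast
    moreover have "Restr le I = le" using le(1) by blast
    ultimately show ?thesis
      using cocone_chain_Union(2)
          [where J = J and f = f, OF \<open>I \<noteq> {}\<close> le JI(1) JI(2) cc compatible[OF f f]]
      by auto
  qed
qed

section \<open>The objects that embed in an absolutely homogeneous object\<close>

lemma prec_AB_HO_iff_generated:
  assumes X: "AB_HO C X" and Y: "Y \<in> Obj C"
  shows "prec C Y X \<longleftrightarrow> Y \<in> generated C sz (Fin C sz X)"
proof
  assume "prec C Y X"
  then show "Y \<in> generated C sz (Fin C sz X)"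
    using Y prec_trans unfolding generated_def Fin_def by blast
next
  assume gen: "Y \<in> generated C sz (Fin C sz X)"
  show "prec C Y X"
  proof (cases "finite_size sz Y")
    case True
    then show ?thesis using gen Y prec_refl unfolding generated_def Fin_def by blast
  next
    case False
    then obtain I :: "'u set" and le Z p L q where sys: "direct_system \<kappa> C I le Z p"
      and fin: "\<forall>i \<in> I. finite_size sz (Z i)" and L: "direct_limit C I le Z p L q"
      and YL: "isomorphic C Y L"
      using Lim[OF Y] by blast
    have "prec C (Z i) X" if i: "i \<in> I" for i
    proof -
      have "prec C (Z i) L" using L i unfolding direct_limit_def cocone_def prec_def by blast
      then have "prec C (Z i) Y" using isomorphic_imp_prec[OF YL] prec_trans by blast
      then show ?thesis
        using gen fin i sys unfolding generated_def Fin_def direct_system_def by blast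
    qed
    then obtain r where "cocone C I le Z p X r"
      using AB_HO_cocone_exists[OF X sys] by blast
    from direct_limit_factor[OF L this] have "prec C L X" unfolding prec_def by blast
    moreover have "prec C Y L" using YL by (auto simp: isomorphic_def Iso_def prec_def)
    ultimately show ?thesis using prec_trans by blast
  qed
qed

lemma finitary_structure_Fin: "finitary_structure C sz (Fin C sz X)"
  unfolding finitary_structure_def
proof (intro conjI ballI impI)
  show "closed_under_iso C (Fin C sz X)"
    unfolding closed_under_iso_def
  proof (intro ballI impI)
    fix A B assume A: "A \<in> Fin C sz X" and B: "B \<in> Obj C" and iso: "isomorphic C A B"
    have "|Field (sz A)| =o |Field (sz B)|"
      using Card_iso[OF _ B iso] A by (intro card_of_cong) (simp add: Fin_def)
    then have "finite_size sz B"
      using A card_of_ordIso_finite unfolding Fin_def finite_size_def by blast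
    then show "B \<in> Fin C sz X"
      using A B isomorphic_imp_prec[OF iso] prec_trans unfolding Fin_def by blast
  qed
qed (use prec_trans in \<open>auto simp: Fin_def\<close>)

text \<open>Arbitrary arrows \<open>y : Y \<rightarrow> X\<close> and \<open>z : Z \<rightarrow> X\<close> induce two arrows \<open>A \<rightarrow> X\<close>; correcting \<open>y\<close> by
  an automorphism of \<open>X\<close> makes these equal.\<close>

lemma AB_HO_amalgamate:
  assumes X: "AB_HO C X" and u: "u \<in> Mor C A Y" and v: "v \<in> Mor C A Z"
    and "prec C Y X" "prec C Z X"
  obtains y z where "y \<in> Mor C Y X" "z \<in> Mor C Z X" "Comp C y u = Comp C z v"
proof -
  obtain y z where y: "y \<in> Mor C Y X" and z: "z \<in> Mor C Z X"
    using assms by (auto simp: prec_def)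
  obtain \<phi> where \<phi>: "\<phi> \<in> Mor C X X" "Comp C z v = Comp C \<phi> (Comp C y u)"
    using X Comp_in_Mor[OF u y] Comp_in_Mor[OF v z] Mor_ObjD(1)[OF u]
    unfolding AB_HO_def Aut_def Iso_def by blast
  then show ?thesis
    using that[of "Comp C \<phi> y" z] Comp_in_Mor[OF y \<phi>(1)] z Comp_assoc[OF u y \<phi>(1)] by simp
qed

text \<open>The amalgam in \<open>X\<close> factors through an object \<open>W\<close> of finite size by (Dir); the square already
  commutes in \<open>W\<close> because \<open>\<gamma> : W \<rightarrow> X\<close> is a monomorphism.\<close>

lemma AP_Fin_AB_HO:
  assumes X: "AB_HO C X"
  shows "AP C (Fin C sz X)"
  unfolding AP_def
proof (intro conjI ballI)
  fix A Y Z u v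
  assume F: "A \<in> Fin C sz X" "Y \<in> Fin C sz X" "Z \<in> Fin C sz X"
    and u: "u \<in> Mor C A Y" and v: "v \<in> Mor C A Z"
  obtain y z where y: "y \<in> Mor C Y X" and z: "z \<in> Mor C Z X" and eq: "Comp C y u = Comp C z v"
    using AB_HO_amalgamate[OF X u v] F unfolding Fin_def by blast
  obtain W \<alpha> \<beta> \<gamma> where W: "W \<in> Obj C" "finite_size sz W"
    and \<alpha>: "\<alpha> \<in> Mor C Y W" and \<beta>: "\<beta> \<in> Mor C Z W" and \<gamma>: "\<gamma> \<in> Mor C W X"
    and yz: "y = Comp C \<gamma> \<alpha>" "z = Comp C \<gamma> \<beta>"
    using Dir[OF _ _ _ _ _ y z] F Mor_ObjD(2)[OF y] unfolding Fin_def by blast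
  have "Comp C \<gamma> (Comp C \<alpha> u) = Comp C \<gamma> (Comp C \<beta> v)"
    using eq yz Comp_assoc[OF u \<alpha> \<gamma>] Comp_assoc[OF v \<beta> \<gamma>] by simp
  then have "Comp C \<alpha> u = Comp C \<beta> v"
    using Comp_cancel[OF \<gamma>] Comp_in_Mor[OF u \<alpha>] Comp_in_Mor[OF v \<beta>] by blast
  moreover have "W \<in> Fin C sz X" using W \<gamma> by (auto simp: Fin_def prec_def)
  ultimately show "\<exists>W \<in> Fin C sz X. \<exists>p \<in> Mor C Y W. \<exists>q \<in> Mor C Z W. Comp C p u = Comp C q v"
    using \<alpha> \<beta> by blast
next
  fix Y Z assume F: "Y \<in> Fin C sz X" "Z \<in> Fin C sz X"
  then obtain y z where y: "y \<in> Mor C Y X" and z: "z \<in> Mor C Z X"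
    by (auto simp: Fin_def prec_def)
  then show "\<exists>W \<in> Fin C sz X. prec C Y W \<and> prec C Z W"
    using Dir[OF _ _ _ _ _ y z] F Mor_ObjD(2)[OF y] unfolding Fin_def prec_def by blast
qed

lemma AP_prec_AB_HO:
  assumes X: "AB_HO C X"
  shows "AP C {Y \<in> Obj C. prec C Y X}"
proof -
  have "X \<in> Obj C" using X by (simp add: AB_HO_def)
  then have XE: "X \<in> {Y \<in> Obj C. prec C Y X}" using prec_refl by simp
  show ?thesis
    unfolding AP_def
  proof (intro conjI ballI)
    fix A Y Z u v
    assume YZ: "Y \<in> {Y \<in> Obj C. prec C Y X}" "Z \<in> {Y \<in> Obj C. prec C Y X}"
      and u: "u \<in> Mor C A Y" and v: "v \<in> Mor C A Z"
    have "prec C Y X" "prec C Z X" using YZ by auto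
    from AB_HO_amalgamate[OF X u v this]
    show "\<exists>W \<in> {Y \<in> Obj C. prec C Y X}. \<exists>p \<in> Mor C Y W. \<exists>q \<in> Mor C Z W.
        Comp C p u = Comp C q v"
      using XE by metis
  next
    fix Y Z
    assume "Y \<in> {Y \<in> Obj C. prec C Y X}" "Z \<in> {Y \<in> Obj C. prec C Y X}"
    then show "\<exists>W \<in> {Y \<in> Obj C. prec C Y X}. prec C Y W \<and> prec C Z W"
      using XE by blast
  qed
qed

section \<open>Properness\<close>

text \<open>Finite parts determine factorisation.  Let \<open>Y\<close> be the limit of finite-size objects \<open>Z i\<close>.  The
  factorisations through \<open>y'\<close> of the arrows \<open>Z i \<rightarrow> Y \<rightarrow> X\<close> are unique, since \<open>y'\<close> is a
  monomorphism; so they form a cocone to \<open>Y'\<close>, and it induces the required arrow.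
  If \<open>Y\<close> itself has finite size, the hypothesis applies to its identity.\<close>

lemma factor_through_if_finite_parts:
  assumes y: "y \<in> Mor C Y X" and y': "y' \<in> Mor C Y' X"
    and fin: "\<And>A a. A \<in> Obj C \<Longrightarrow> finite_size sz A \<Longrightarrow> a \<in> Mor C A Y \<Longrightarrow>
      \<exists>b \<in> Mor C A Y'. Comp C y a = Comp C y' b"
  shows "\<exists>h \<in> Mor C Y Y'. Comp C y' h = y"
proof (cases "finite_size sz Y")
  case True
  have Y: "Y \<in> Obj C" using Mor_ObjD y by blast
  from fin[OF Y True Ident_in_Mor[OF Y]] show ?thesis using Ident_right[OF y] by metis
next
  case False
  then obtain I :: "'u set" and le Z p L q where sys: "direct_system \<kappa> C I le Z p"
    and finZ: "\<forall>i \<in> I. finite_size sz (Z i)" and L: "direct_limit C I le Z p L q"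
    and YL: "isomorphic C Y L"
    using Lim[OF Mor_ObjD(1)[OF y]] by blast
  obtain s t where s: "s \<in> Mor C Y L" and t: "t \<in> Mor C L Y" and ts: "Comp C t s = Ident C Y"
    using YL unfolding isomorphic_def Iso_def by blast
  have yt: "Comp C y t \<in> Mor C L X" using Comp_in_Mor t y by blast
  have cc: "cocone C I le Z p L q" using L by (simp add: direct_limit_def)
  have q: "q i \<in> Mor C (Z i) L" if "i \<in> I" for i using cc that unfolding cocone_def by blast
  have "\<exists>b \<in> Mor C (Z i) Y'. Comp C (Comp C y t) (q i) = Comp C y' b" if i: "i \<in> I" for i
    using fin[of "Z i" "Comp C t (q i)"] finZ i sys Comp_in_Mor[OF q[OF i] t]
      Comp_assoc[OF q[OF i] t y] unfolding direct_system_def by metis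
  then obtain b where b: "\<And>i. i \<in> I \<Longrightarrow> b i \<in> Mor C (Z i) Y'"
    and yb: "\<And>i. i \<in> I \<Longrightarrow> Comp C (Comp C y t) (q i) = Comp C y' (b i)" by metis
  have "cocone C I le Z p Y' b"
    unfolding cocone_def
  proof (intro conjI ballI allI impI)
    show "Y' \<in> Obj C" using y' Mor_ObjD by blast
  next
    fix i assume "i \<in> I" then show "b i \<in> Mor C (Z i) Y'" by (rule b)
  next
    fix i j assume ij: "(i, j) \<in> le"
    then have I: "i \<in> I" "j \<in> I" and p: "p i j \<in> Mor C (Z i) (Z j)"
      using sys unfolding direct_system_def directed_set_def by blast+
    have "Comp C y' (Comp C (b j) (p i j)) = Comp C (Comp C (Comp C y t) (q j)) (p i j)"
      using Comp_assoc[OF p b[OF I(2)] y'] yb[OF I(2)] by simp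
    also have "\<dots> = Comp C (Comp C y t) (q i)"
      using Comp_assoc[OF p q[OF I(2)] yt] cc ij unfolding cocone_def by metis
    also have "\<dots> = Comp C y' (b i)" by (rule yb[OF I(1)])
    finally show "Comp C (b j) (p i j) = b i"
      using Comp_cancel[OF y' Comp_in_Mor[OF p b[OF I(2)]] b[OF I(1)]] by blast
  qed
  then obtain h where h: "h \<in> Mor C L Y'" and hq: "\<And>i. i \<in> I \<Longrightarrow> Comp C h (q i) = b i"
    using direct_limit_factor[OF L] by blast
  have "Comp C y' h = Comp C y t"
  proof (rule direct_limit_eqI[OF sys L Comp_in_Mor[OF h y'] yt])
    fix i assume i: "i \<in> I"
    show "Comp C (Comp C y' h) (q i) = Comp C (Comp C y t) (q i)"
      using Comp_assoc[OF q[OF i] h y'] hq[OF i] yb[OF i] by simp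
  qed
  then have "Comp C y' (Comp C h s) = y"
    using Comp_assoc[OF s h y'] Comp_assoc[OF s t y] ts Ident_right[OF y] by simp
  then show ?thesis using Comp_in_Mor[OF s h] by blast
qed

lemma isomorphic_if_mutual_factor:
  assumes y: "y \<in> Mor C Y X" and y': "y' \<in> Mor C Y' X"
    and h: "h \<in> Mor C Y Y'" "Comp C y' h = y" and k: "k \<in> Mor C Y' Y" "Comp C y k = y'"
  shows "isomorphic C Y Y'"
proof -
  have "Comp C k h = Ident C Y"
    using Comp_cancel[OF y Comp_in_Mor[OF h(1) k(1)] Ident_in_Mor[OF Mor_ObjD(1)[OF y]]]
      Comp_assoc[OF h(1) k(1) y] h k Ident_right[OF y] by simp
  moreover have "Comp C h k = Ident C Y'"
    using Comp_cancel[OF y' Comp_in_Mor[OF k(1) h(1)] Ident_in_Mor[OF Mor_ObjD(1)[OF y']]]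
      Comp_assoc[OF k(1) h(1) y'] h k Ident_right[OF y'] by simp
  ultimately show ?thesis using h k unfolding isomorphic_def Iso_def by blast
qed

text \<open>\<open>T Y\<close> records which arrows \<open>B \<rightarrow> X\<close>, with \<open>B\<close> in a small set \<open>W\<close> of representatives of
  \<open>Fin C sz X\<close>, factor through a fixed arrow \<open>m Y : Y \<rightarrow> X\<close>.  If \<open>T Y = T Y'\<close>, then \<open>m Y\<close> and
  \<open>m Y'\<close> factor through each other, so \<open>Y\<close> and \<open>Y'\<close> are isomorphic.  As there are few values of
  \<open>T\<close>, one object per value gives a small set of representatives.\<close>

lemma proper_prec:
  assumes \<kappa>: "inaccessible \<kappa>" and X: "X \<in> Obj C"
  shows "proper \<kappa> C {Y \<in> Obj C. prec C Y X}"
proof -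
  obtain W where W: "W \<subseteq> Obj C" "small \<kappa> W" "\<forall>A \<in> Fin C sz X. \<exists>B \<in> W. isomorphic C A B"
    using Fin[OF X] unfolding proper_def by blast
  define E where "E = {Y \<in> Obj C. prec C Y X}"
  have "\<exists>m. \<forall>Y \<in> E. m Y \<in> Mor C Y X" unfolding E_def prec_def by (intro bchoice) auto
  then obtain m where m: "\<And>Y. Y \<in> E \<Longrightarrow> m Y \<in> Mor C Y X" by blast
  define S where "S = (\<Union>B \<in> W. Mor C B X)"
  define T where "T Y = {c \<in> S. \<exists>b \<in> Mor C (Dom C c) Y. c = Comp C (m Y) b}" for Y
  have factor: "\<exists>h \<in> Mor C Y Y'. Comp C (m Y') h = m Y"
    if Y: "Y \<in> E" "Y' \<in> E" and TT: "T Y = T Y'" for Y Y'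
  proof (rule factor_through_if_finite_parts[OF m[OF Y(1)] m[OF Y(2)]])
    fix A a assume A: "A \<in> Obj C" "finite_size sz A" and a: "a \<in> Mor C A Y"
    note ma = Comp_in_Mor[OF a m[OF Y(1)]]
    then have "A \<in> Fin C sz X" using A unfolding Fin_def prec_def by blast
    then obtain B e e' where B: "B \<in> W" and e: "e \<in> Mor C A B" and e': "e' \<in> Mor C B A"
      and e'e: "Comp C e' e = Ident C A"
      using W(3) unfolding isomorphic_def Iso_def by blast
    \<comment> \<open>\<open>m Y \<circ> a\<close> transported to the representative \<open>B\<close> of its domain.\<close>
    define c where "c = Comp C (m Y) (Comp C a e')"
    have ae': "Comp C a e' \<in> Mor C B Y" using Comp_in_Mor a e' by blast
    then have "c \<in> Mor C B X" unfolding c_def using m[OF Y(1)] Comp_in_Mor by blast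
    then have D: "Dom C c = B" and "c \<in> S" using B unfolding S_def Mor_def by blast+
    then have "c \<in> T Y" unfolding T_def c_def using ae' by auto
    then obtain b where b: "b \<in> Mor C B Y'" and cb: "c = Comp C (m Y') b"
      using TT D unfolding T_def by blast
    have "Comp C (m Y') (Comp C b e) = Comp C c e"
      using Comp_assoc[OF e b m[OF Y(2)]] cb by simp
    also have "\<dots> = Comp C (m Y) (Comp C a (Comp C e' e))"
      using Comp_assoc[OF e ae' m[OF Y(1)]] Comp_assoc[OF e e' a] unfolding c_def by simp
    also have "\<dots> = Comp C (m Y) a" using e'e Ident_right[OF a] by simp
    finally show "\<exists>b \<in> Mor C A Y'. Comp C (m Y) a = Comp C (m Y') b"
      using Comp_in_Mor[OF e b] by metis
  qed
  define V where "V = inv_into E T ` (T ` E)"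
  have iso: "isomorphic C Y (inv_into E T (T Y))" if Y: "Y \<in> E" for Y
  proof -
    let ?Y' = "inv_into E T (T Y)"
    have Y': "?Y' \<in> E" "T ?Y' = T Y"
      using imageI[OF Y, of T] by (rule inv_into_into, rule f_inv_into_f)
    obtain h where h: "h \<in> Mor C Y ?Y'" "Comp C (m ?Y') h = m Y"
      using factor[OF Y Y'(1)] Y'(2) by auto
    obtain k where k: "k \<in> Mor C ?Y' Y" "Comp C (m Y) k = m ?Y'"
      using factor[OF Y'(1) Y] Y'(2) by auto
    show ?thesis by (rule isomorphic_if_mutual_factor[OF m[OF Y] m[OF Y'(1)] h k])
  qed
  have "small \<kappa> S"
    unfolding S_def using W Arr_small[OF _ X] by (intro small_UN[OF \<kappa>]) auto
  moreover have "T ` E \<subseteq> Pow S" by (auto simp: T_def)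
  ultimately have "small \<kappa> (T ` E)"
    using small_subset[OF small_Pow[OF \<kappa>]] by blast
  then have "small \<kappa> V" unfolding V_def by (rule small_image)
  moreover have "V \<subseteq> Obj C"
  proof
    fix V' assume "V' \<in> V"
    then obtain t where "t \<in> T ` E" "V' = inv_into E T t" unfolding V_def by (rule imageE)
    then have "V' \<in> E" by (simp add: inv_into_into)
    then show "V' \<in> Obj C" by (simp add: E_def)
  qed
  moreover have "\<forall>Y \<in> E. \<exists>V' \<in> V. isomorphic C Y V'"
  proof
    fix Y assume Y: "Y \<in> E"
    then have "inv_into E T (T Y) \<in> V" unfolding V_def by (intro imageI)
    with iso[OF Y] show "\<exists>V' \<in> V. isomorphic C Y V'" ..
  qed
  ultimately have "proper \<kappa> C E" unfolding proper_def by blast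
  then show ?thesis by (simp only: E_def)
qed

end

section \<open>Absolutely homogeneous objects and their finite parts\<close>

theorem theorem9p11:
  fixes \<kappa> :: "'u rel" and C :: "('o, 'a) cat" and sz :: "'o \<Rightarrow> 'u rel" and X :: 'o
    and F :: "'o set"
  assumes "inaccessible \<kappa>"
    and "cardinal_category \<kappa> C sz"
    and "AB_HO C X"
    and F_def: "F = Fin C sz X"
  shows "(\<forall>Y \<in> Obj C. prec C Y X \<longleftrightarrow> Y \<in> generated C sz F) \<and>
    (proper \<kappa> C F \<and> finitary_structure C sz F \<and> AP C F) \<and>
    (proper \<kappa> C (generated C sz F) \<and> AP C (generated C sz F))"
proof -
  interpret cardinal_category \<kappa> C sz by fact
  have X: "X \<in> Obj C" using assms(3) by (simp add: AB_HO_def)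
  have A: "\<forall>Y \<in> Obj C. prec C Y X \<longleftrightarrow> Y \<in> generated C sz F"
    using prec_AB_HO_iff_generated[OF assms(3)] F_def by blast
  moreover have "proper \<kappa> C F" "finitary_structure C sz F" "AP C F"
    using Fin[OF X] finitary_structure_Fin AP_Fin_AB_HO[OF assms(3)] by (simp_all add: F_def)
  moreover have "generated C sz F = {Y \<in> Obj C. prec C Y X}"
    using A by (auto simp: generated_def)
  ultimately show ?thesis
    using proper_prec[OF assms(1) X] AP_prec_AB_HO[OF assms(3)] by simp
qed

end
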